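(* Let $$S=\left\{\left(x,\;x-\tfrac{8}{9}x^2\right)\;\middle|\;x=\tfrac{3}{4k},\ k\in\mathbb{Z},\ k\ge 1\right\}\subset\mathbb{R}^2,\qquad I=\{(x,y)\in\mathbb{R}^2\mid 0\le x\le 1,\ y=0\}.$$ Let $(x,y)$ be any point with rational coordinates in the convex hull of $S\cup I$. Then there exist integers $n,p,q,j$ with $p,q\ge 1$, $0\le n\le pq$, and $j\ge 0$ such that $x=n/(pq)$, $y=j/(pq)$, and $H_j[C(n;p,q)]\neq 0$.
   Context: $C(n;p,q)$ is the ordered configuration space of $n$ unit squares in a $p\times q$ rectangle. It is the subspace of $\mathbb{R}^{2n}$ of all points $(x_1,y_1,\dots,x_n,y_n)$ such that $1\le x_k\le p$ and $1\le y_k\le q$ for all $1\le k\le n$, and such that $|x_k-x_\ell|\ge 1$ or $|y_k-y_\ell|\ge 1$ for all $1\le k<\ell\le n$. $H_j$ denotes singular homology with integer coefficients. *)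

theory Defs
  imports "HOL-Homology.Homology"
begin

text \<open>
  A point of \<open>\<real>\<^sup>2\<^sup>n\<close> is an element \<open>z\<close> of \<^term>\<open>Euclidean_space (2 * n)\<close>, read as
  \<open>(x\<^sub>1, y\<^sub>1, \<dots>, x\<^sub>n, y\<^sub>n)\<close> with indices shifted to start at 0: the square with index
  \<open>k < n\<close> has \<open>x\<close>-coordinate \<open>z (2 * k)\<close> and \<open>y\<close>-coordinate \<open>z (2 * k + 1)\<close>.
\<close>

definition square_config_space :: "nat \<Rightarrow> nat \<Rightarrow> nat \<Rightarrow> (nat \<Rightarrow> real) topology" where
  "square_config_space n p q =
     subtopology (Euclidean_space (2 * n))
       {z. (\<forall>k<n. 1 \<le> z (2 * k) \<and> z (2 * k) \<le> real p \<and>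
                  1 \<le> z (2 * k + 1) \<and> z (2 * k + 1) \<le> real q) \<and>
           (\<forall>k l. k < l \<and> l < n \<longrightarrow>
                  \<bar>z (2 * k) - z (2 * l)\<bar> \<ge> 1 \<or>
                  \<bar>z (2 * k + 1) - z (2 * l + 1)\<bar> \<ge> 1)}"

definition parabola_points :: "(real \<times> real) set" where
  "parabola_points =
     {(x, x - 8 / 9 * x ^ 2) | (x::real) (k::int). x = 3 / (4 * of_int k) \<and> k \<ge> 1}"

definition base_segment :: "(real \<times> real) set" where
  "base_segment = {(x, y). 0 \<le> x \<and> x \<le> 1 \<and> y = 0}"

end

theory Submission
  imports Defs
begin

text \<open>
  A torus of dimension \<open>j\<close> of configurations carries a nonzero class of degree \<open>j\<close> as soon as each of its
  circle coordinates can be read off, up to homotopy, from the direction between two of the squares: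
  the torus is then a homotopy retract of the configuration space, and its top homology is nonzero.

  The point of \<open>S\<close> with parameter \<open>k\<close> is realised by \<open>3k\<close> squares in a \<open>2k \<times> 2k\<close> box and \<open>j = 3k - 2\<close>.
  The squares form three clusters of \<open>k\<close> squares, each confined to a \<open>k \<times> k\<close> box. Inside a cluster, each new
  square orbits around the previous ones, which gives \<open>k - 1\<close> circles; and the three boxes rotate in the
  four quadrants of the big box like three pieces of a sliding puzzle with one hole, which
  gives one more circle. Full boxes and empty boxes realise \<open>(1, 0)\<close> and \<open>(0, 0)\<close>, and tilings by such
  boxes realise all rational convex combinations.
\<close>

section \<open>Homology of tori\<close>


lemma hom_induced_iso_eq_one:
  assumes "hom_induced p X S Y T f \<in> iso (relative_homology_group p X S) (relative_homology_group p Y T)"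
    and "x \<in> carrier (relative_homology_group p X S)"
    and "hom_induced p X S Y T f x = \<one>\<^bsub>relative_homology_group p Y T\<^esub>"
  shows "x = \<one>\<^bsub>relative_homology_group p X S\<^esub>"
proof (rule inj_onD)
  show "inj_on (hom_induced p X S Y T f) (carrier (relative_homology_group p X S))"
    using assms(1) by (simp add: iso_iff)
  show "hom_induced p X S Y T f x = hom_induced p X S Y T f \<one>\<^bsub>relative_homology_group p X S\<^esub>"
    using assms(3) by (simp add: hom_one [OF hom_induced_hom])
qed (use assms(2) in \<open>auto simp: group.is_monoid\<close>)

text \<open>The map of pairs factors through the pair of \<open>X\<close> with itself, whose
  relative homology vanishes.\<close>

lemma hom_induced_trivial_if_in_subspace:
  assumes f: "continuous_map X Y f" and im: "f \<in> topspace X \<rightarrow> T"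
  shows "hom_induced p X {} Y T f c = \<one>\<^bsub>relative_homology_group p Y T\<^esub>"
proof -
  have "hom_induced p X {} Y T f c
      = hom_induced p X (topspace X) Y T f (hom_induced p X {} X (topspace X) id c)"
    using hom_induced_compose' [of X X id "{}" "topspace X" Y f T p c] f im by simp
  moreover have "hom_induced p X {} X (topspace X) id c = \<one>\<^bsub>relative_homology_group p X (topspace X)\<^esub>"
    using trivial_relative_homology_group_topspace [of p X]
      hom_induced_carrier [of p X "{}" X "topspace X" id c]
    by (simp add: trivial_group_def)
  ultimately show ?thesis
    by (simp add: hom_one [OF hom_induced_hom])
qed

lemma continuous_map_constant_section:
  assumes "c \<in> C" "c \<in> topspace Z"
  shows "continuous_map X (subtopology (prod_topology X Z) {w. snd w \<in> C}) (\<lambda>x. (x, c))"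
  using assms by (auto simp: continuous_map_in_subtopology continuous_map_pairwise o_def)

lemma homotopic_constant_sections:
  assumes g: "pathin (subtopology Z C) g"
  shows "homotopic_with (\<lambda>_. True) X (subtopology (prod_topology X Z) {w. snd w \<in> C})
           (\<lambda>x. (x, g 0)) (\<lambda>x. (x, g 1))"
proof -
  let ?h = "\<lambda>w. (snd w, (g \<circ> fst) w)"
  have g': "continuous_map (top_of_set {0..1}) Z g" and im: "g \<in> {0..1} \<rightarrow> C"
    using g by (auto simp: pathin_def continuous_map_in_subtopology)
  have "continuous_map (prod_topology (top_of_set {0..1}) X) (prod_topology X Z) ?h"
    using g' by (intro continuous_map_pairedI continuous_map_snd continuous_map_compose [OF continuous_map_fst])
  then have "continuous_map (prod_topology (top_of_set {0..1}) X)
               (subtopology (prod_topology X Z) {w. snd w \<in> C}) ?h"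
    using im by (auto simp: continuous_map_in_subtopology)
  then show ?thesis
    unfolding homotopic_with_def by (intro exI [of _ ?h]) auto
qed

text \<open>
  With \<open>a\<close> and \<open>b\<close> the images of a class of \<open>X\<close> over \<open>\<i>\<close> and \<open>-\<i>\<close>, the difference \<open>a - b\<close> bounds over
  the right half of the circle and over the left half; gluing the two gives a class of
  \<open>X \<times> S\<^sup>1\<close> one dimension higher.
\<close>
proposition nontrivial_homology_prod_circle:
  fixes X :: "'a topology" and p :: int
  assumes "\<not> trivial_group (homology_group p X)"
  shows "\<not> trivial_group (homology_group (p + 1) (prod_topology X (top_of_set (sphere (0::complex) 1))))"
proof
  define Z where "Z = top_of_set (sphere (0::complex) 1)"
  define Y where "Y = prod_topology X Z"
  \<comment> \<open>\<open>T\<close> lies over the closed left half of the circle. Removing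
    \<open>U\<close> leaves \<open>B\<close>, over one large arc, and \<open>E\<close>, over two
    short arcs, one ending at \<open>\<i>\<close> and one at \<open>-\<i>\<close>; \<open>M\<close>
    selects the lower one.\<close>
  define T :: "('a \<times> complex) set" where "T = {w. snd w \<in> {z. Re z \<le> 0}}"
  define U :: "('a \<times> complex) set" where "U = {w. snd w \<in> {z. Re z < -1/2}}"
  define B where "B = subtopology Y (UNIV - U)"
  define E where "E = subtopology B (T - U)"
  define M :: "('a \<times> complex) set" where "M = {w. snd w \<in> {z. Im z < 0}}"
  assume "trivial_group (homology_group (p + 1) (prod_topology X (top_of_set (sphere (0::complex) 1))))"
  then have trivY: "trivial_group (homology_group (p + 1) Y)"
    by (simp add: Y_def Z_def)
  let ?f = "\<lambda>x::'a. (x, \<i>)" and ?g = "\<lambda>x::'a. (x, -\<i>)"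
  have B_eq: "B = subtopology Y {w. snd w \<in> {z. -1/2 \<le> Re z}}"
    unfolding B_def U_def by (rule arg_cong2 [where f = subtopology]) auto
  have E_eq: "E = subtopology Y {w. snd w \<in> {z. -1/2 \<le> Re z \<and> Re z \<le> 0}}"
    unfolding E_def B_eq subtopology_subtopology T_def U_def
    by (rule arg_cong2 [where f = subtopology]) auto
  have cts: "continuous_map Y euclidean snd"
    unfolding Y_def Z_def using continuous_map_into_fulltopology continuous_map_snd by blast
  have op: "openin Y {w \<in> topspace Y. snd w \<in> V}" if "open V" for V
    using openin_continuous_map_preimage [OF cts] that by simp
  have cl: "closedin Y {w \<in> topspace Y. snd w \<in> V}" if "closed V" for V
    using closedin_continuous_map_preimage [OF cts] that by simp
  \<comment> \<open>The hypothesis of excision: the closure of \<open>U\<close> lies over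
    \<open>Re z \<le> -1/2\<close>, hence inside the interior of \<open>T\<close>.\<close>
  have "Y closure_of U = Y closure_of {w \<in> topspace Y. snd w \<in> {z. Re z < -1/2}}"
    by (subst closure_of_restrict) (auto simp: U_def intro!: arg_cong2 [where f = "(closure_of)"])
  also have "\<dots> \<subseteq> {w \<in> topspace Y. snd w \<in> {z. Re z \<le> -1/2}}"
    by (intro closure_of_minimal cl closed_Collect_le continuous_intros) auto
  also have "\<dots> \<subseteq> {w \<in> topspace Y. snd w \<in> {z. Re z < 0}}"
    by auto
  also have "\<dots> \<subseteq> Y interior_of T"
    by (intro interior_of_maximal op open_Collect_less continuous_intros) (auto simp: T_def)
  finally have exc: "hom_induced q B (T - U) Y T id
      \<in> iso (relative_homology_group q B (T - U)) (relative_homology_group q Y T)" for q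
    using homology_excision_axiom [of Y U T UNIV q] by (simp add: B_def)

  have f_E: "continuous_map X E ?f" and g_E: "continuous_map X E ?g"
    unfolding E_eq Y_def by (rule continuous_map_constant_section; simp add: Z_def)+
  have inc_B: "continuous_map E B id"
    by (simp add: E_def)
  have inc_Y: "continuous_map B Y id"
    by (simp add: B_def)
  have inc_T: "continuous_map E (subtopology Y T) id"
    using continuous_map_compose [OF inc_B inc_Y]
    by (auto simp: continuous_map_in_subtopology E_def)
  \<comment> \<open>From \<open>\<i>\<close> to \<open>-\<i>\<close>, \<open>s = 1\<close> follows
    the right half of the circle and \<open>s = -1\<close> the left half.\<close>
  have path: "homotopic_with (\<lambda>_. True) X (subtopology Y {w. snd w \<in> C}) ?f ?g"
    if s: "s\<^sup>2 = 1" and C: "\<And>t. t \<in> {0..1} \<Longrightarrow> Complex (s * sin (pi * t)) (cos (pi * t)) \<in> C" for s C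
  proof -
    let ?\<gamma> = "\<lambda>t. Complex (s * sin (pi * t)) (cos (pi * t))"
    have "norm (?\<gamma> t) = 1" for t
      using s by (simp add: cmod_def power_mult_distrib)
    moreover have "continuous_on {0..1} ?\<gamma>"
      unfolding Complex_eq by (intro continuous_intros)
    ultimately have "pathin (subtopology Z C) ?\<gamma>"
      using C by (auto simp: pathin_def Z_def continuous_map_in_subtopology)
    from homotopic_constant_sections [OF this, of X] show ?thesis
      by (simp add: Y_def Complex_eq)
  qed
  have hB: "homotopic_with (\<lambda>_. True) X B ?f ?g"
    unfolding B_eq by (rule path [of 1]) (auto intro: order_trans [OF _ sin_ge_zero])
  have hT: "homotopic_with (\<lambda>_. True) X (subtopology Y T) ?f ?g"
    unfolding T_def by (rule path [of "-1"]) (auto intro: sin_ge_zero)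

  let ?E = "homology_group p E"
  interpret E: comm_group ?E
    by simp
  obtain \<alpha> where \<alpha>: "\<alpha> \<in> carrier (homology_group p X)" "\<alpha> \<noteq> \<one>\<^bsub>homology_group p X\<^esub>"
    using assms group_relative_homology_group [of p X "{}"]
    by (metis group.is_monoid group.trivial_group_alt subsetI singletonI)
  define a where "a = hom_induced p X {} E {} ?f \<alpha>"
  define b where "b = hom_induced p X {} E {} ?g \<alpha>"
  define c where "c = a \<otimes>\<^bsub>?E\<^esub> inv\<^bsub>?E\<^esub> b"
  have ab: "a \<in> carrier ?E" "b \<in> carrier ?E" and c: "c \<in> carrier ?E"
    by (simp_all add: a_def b_def c_def hom_induced_carrier)
  have kill: "hom_induced p E {} W {} id c = \<one>\<^bsub>homology_group p W\<^esub>"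
    if W: "continuous_map E W id" and h: "homotopic_with (\<lambda>_. True) X W ?f ?g" for W
  proof -
    interpret W: comm_group "homology_group p W"
      by simp
    interpret EW: group_hom ?E "homology_group p W" "hom_induced p E {} W {} id"
      by (simp add: group_hom_def group_hom_axioms_def hom_induced_empty_hom)
    have "hom_induced p E {} W {} id a = hom_induced p E {} W {} id b"
      using homology_homotopy_empty [OF h, of p] hom_induced_compose_empty [OF f_E W, of p]
        hom_induced_compose_empty [OF g_E W, of p]
      by (simp add: a_def b_def fun_eq_iff)
    then show ?thesis
      using ab by (simp add: c_def)
  qed

  obtain \<beta> where \<beta>: "\<beta> \<in> carrier (relative_homology_group (p + 1) B (T - U))"
      "hom_boundary (p + 1) B (T - U) \<beta> = c"
  proof -
    have "c \<in> kernel ?E (homology_group p B) (hom_induced p E {} B {} id)"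
      using kill [OF inc_B hB] c by (simp add: kernel_def)
    also have "\<dots> = hom_boundary (p + 1) B (T - U) ` carrier (relative_homology_group (p + 1) B (T - U))"
      using homology_exactness_axiom_2 [of "p + 1" B "T - U"] by (simp add: E_def)
    finally show thesis
      using that by blast
  qed
  \<comment> \<open>This is the glued class. Its boundary dies in \<open>T\<close>, so it lifts to
    degree \<open>p + 1\<close> of \<open>Y\<close>. That group is assumed trivial, so excision
    kills \<open>\<beta>\<close>, and the boundary map then kills \<open>c\<close>.\<close>
  define \<gamma> where "\<gamma> = hom_induced (p + 1) B (T - U) Y T id \<beta>"
  have "hom_boundary (p + 1) Y T \<gamma> = hom_induced p E {} (subtopology Y T) {} id c"
    using naturality_hom_induced [OF inc_Y, of "T - U" T "p + 1"] \<beta>(2)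
    by (auto simp: \<gamma>_def E_def fun_eq_iff)
  also have "\<dots> = \<one>\<^bsub>homology_group p (subtopology Y T)\<^esub>"
    by (rule kill [OF inc_T hT])
  finally have "\<gamma> \<in> kernel (relative_homology_group (p + 1) Y T) (homology_group p (subtopology Y T))
                   (hom_boundary (p + 1) Y T)"
    by (simp add: kernel_def \<gamma>_def hom_induced_carrier)
  also have "\<dots> = hom_induced (p + 1) Y {} Y T id ` carrier (homology_group (p + 1) Y)"
    using homology_exactness_axiom_1 [of "p + 1" Y T] by simp
  also have "\<dots> = {\<one>\<^bsub>relative_homology_group (p + 1) Y T\<^esub>}"
    using trivY by (simp add: trivial_group_def hom_one [OF hom_induced_hom])
  finally have "\<gamma> = \<one>\<^bsub>relative_homology_group (p + 1) Y T\<^esub>"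
    by simp
  then have "\<beta> = \<one>\<^bsub>relative_homology_group (p + 1) B (T - U)\<^esub>"
    using hom_induced_iso_eq_one [OF exc] \<beta>(1) by (simp add: \<gamma>_def)
  then have "c = \<one>\<^bsub>?E\<^esub>"
    using \<beta>(2) hom_one [OF hom_boundary_hom [of "p + 1" B "T - U"]] by (simp add: E_def)
  then have eq: "a = b"
    using ab by (simp add: c_def E.inv_solve_right')

  \<comment> \<open>The contradiction with \<open>a = b\<close>: modulo \<open>M\<close> the class
    \<open>b\<close> vanishes, while \<open>a\<close> becomes the excised image of
    \<open>\<alpha>\<close> in \<open>N\<close>, from which \<open>fst\<close> recovers
    \<open>\<alpha>\<close>.\<close>
  define N where "N = subtopology E (UNIV - M)"
  have Im_E: "Im (snd w) \<noteq> 0" if "w \<in> topspace E" for w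
  proof
    assume "Im (snd w) = 0"
    with that have "\<bar>Re (snd w)\<bar> = 1" "-1/2 \<le> Re (snd w)" "Re (snd w) \<le> 0"
      by (auto simp: E_eq Y_def Z_def cmod_def)
    then show False
      by linarith
  qed
  have cts_E: "continuous_map E euclidean snd"
    unfolding E_eq by (rule continuous_map_from_subtopology [OF cts])
  \<comment> \<open>\<open>M\<close> is open and closed in \<open>E\<close>, as \<open>E\<close> has
    no point over the real axis; so all of \<open>M\<close> can be excised.\<close>
  have "openin E {w \<in> topspace E. snd w \<in> {z. Im z < 0}}"
    by (intro openin_continuous_map_preimage [OF cts_E]) (simp add: open_Collect_less continuous_intros)
  moreover have "closedin E {w \<in> topspace E. snd w \<in> {z. Im z \<le> 0}}"
    by (intro closedin_continuous_map_preimage [OF cts_E]) (simp add: closed_Collect_le continuous_intros)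
  moreover have "{w \<in> topspace E. snd w \<in> {z. Im z < 0}} = topspace E \<inter> M"
      "{w \<in> topspace E. snd w \<in> {z. Im z \<le> 0}} = topspace E \<inter> M"
    using Im_E by (auto simp: M_def order_le_less)
  ultimately have "E closure_of M \<subseteq> E interior_of M"
    by (metis closure_of_closedin closure_of_restrict interior_of_openin interior_of_restrict order_refl)
  then have excM: "hom_induced p N {} E M id \<in> iso (homology_group p N) (relative_homology_group p E M)"
    using homology_excision_axiom [of E M M UNIV p] by (simp add: N_def)
  have f_N: "continuous_map X N ?f" and inc_N: "continuous_map N E id"
    using f_E by (auto simp: N_def M_def continuous_map_in_subtopology)
  have fst_N: "continuous_map N X fst"
    unfolding N_def E_eq Y_def by (intro continuous_map_from_subtopology continuous_map_fst)
  have "hom_induced p E {} E M id a = hom_induced p X {} E M ?f \<alpha>"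
    using hom_induced_compose' [OF f_E _ continuous_map_id, of "{}" "{}" M p \<alpha>] by (simp add: a_def)
  also have "\<dots> = hom_induced p N {} E M id (hom_induced p X {} N {} ?f \<alpha>)"
    using hom_induced_compose' [OF f_N _ inc_N, of "{}" "{}" M p \<alpha>] by simp
  finally have 1: "hom_induced p E {} E M id a = \<dots>" .
  have "hom_induced p E {} E M id b = hom_induced p X {} E M ?g \<alpha>"
    using hom_induced_compose' [OF g_E _ continuous_map_id, of "{}" "{}" M p \<alpha>] by (simp add: b_def)
  also have "\<dots> = \<one>\<^bsub>relative_homology_group p E M\<^esub>"
    by (rule hom_induced_trivial_if_in_subspace [OF g_E]) (simp add: M_def)
  finally have "hom_induced p N {} E M id (hom_induced p X {} N {} ?f \<alpha>) = \<one>\<^bsub>relative_homology_group p E M\<^esub>"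
    using 1 eq by simp
  then have "hom_induced p X {} N {} ?f \<alpha> = \<one>\<^bsub>homology_group p N\<^esub>"
    by (rule hom_induced_iso_eq_one [OF excM hom_induced_carrier])
  then have "hom_induced p N {} X {} fst (hom_induced p X {} N {} ?f \<alpha>) = \<one>\<^bsub>homology_group p X\<^esub>"
    by (simp add: hom_one [OF hom_induced_hom])
  moreover have "hom_induced p N {} X {} fst (hom_induced p X {} N {} ?f \<alpha>) = \<alpha>"
    using hom_induced_compose' [OF f_N _ fst_N, of "{}" "{}" "{}" p \<alpha>] \<alpha>(1)
    by (simp add: o_def hom_induced_id [unfolded id_def])
  ultimately show False
    using \<alpha>(2) by simp
qed


text \<open>On homology \<open>g\<close> is a left inverse of \<open>f\<close>, so \<open>f\<close>
  is injective there.\<close>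

lemma nontrivial_homology_of_homotopy_section:
  assumes f: "continuous_map X Y f" and g: "continuous_map Y X g"
    and gf: "homotopic_with (\<lambda>_. True) X X (g \<circ> f) id"
    and nontriv: "\<not> trivial_group (homology_group p X)"
  shows "\<not> trivial_group (homology_group p Y)"
proof
  assume Y: "trivial_group (homology_group p Y)"
  have "x = \<one>\<^bsub>homology_group p X\<^esub>" if x: "x \<in> carrier (homology_group p X)" for x
  proof -
    have "x = hom_induced p Y {} X {} g (hom_induced p X {} Y {} f x)"
      using homology_homotopy_empty [OF gf, of p] hom_induced_compose_empty [OF f g, of p] x
      by (simp add: fun_eq_iff hom_induced_id)
    also have "hom_induced p X {} Y {} f x = \<one>\<^bsub>homology_group p Y\<^esub>"
      using Y hom_induced_carrier [of p X "{}" Y "{}" f x] by (simp add: trivial_group_def)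
    finally show ?thesis
      by (simp add: hom_one [OF hom_induced_hom])
  qed
  then have "trivial_group (homology_group p X)"
    by (auto simp: trivial_group_def group.is_monoid)
  then show False
    using nontriv by simp
qed

text \<open>
  Families are parametrised by all sequences on the circle, so that coordinates can be shifted freely;
  the torus of dimension \<open>j\<close> consists of the sequences that are constant from index \<open>j\<close> on.
\<close>

definition circle_tuples :: "(nat \<Rightarrow> complex) set"
  where "circle_tuples = {u. \<forall>i. norm (u i) = 1}"

definition torus_tuples :: "nat \<Rightarrow> (nat \<Rightarrow> complex) set"
  where "torus_tuples j = {u \<in> circle_tuples. \<forall>i\<ge>j. u i = 1}"

lemma continuous_on_coordinate:
  "continuous_on (S :: ('a \<Rightarrow> 'b::topological_space) set) (\<lambda>u. u i)"
  by (rule continuous_on_subset [OF continuous_on_product_coordinates]) simp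

text \<open>Coordinate \<open>j\<close> is the new circle factor; resetting it to the default
  \<open>1\<close> recovers the smaller torus.\<close>

lemma torus_Suc_homeomorphic:
  "prod_topology (top_of_set (torus_tuples j)) (top_of_set (sphere (0::complex) 1))
     homeomorphic_space top_of_set (torus_tuples (Suc j))"
proof -
  have "continuous_on (torus_tuples j \<times> sphere 0 1) (\<lambda>w. (fst w)(j := snd w))"
  proof (rule continuous_on_coordinatewise_then_product)
    fix i
    show "continuous_on (torus_tuples j \<times> sphere 0 1) (\<lambda>w. ((fst w)(j := snd w)) i)"
    proof (cases "i = j")
      case True
      then show ?thesis
        by (simp add: continuous_on_snd)
    next
      case False
      then show ?thesis
        by (simp add: continuous_on_compose2 [OF continuous_on_coordinate [of UNIV] continuous_on_fst])
    qed
  qed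
  moreover have "continuous_on (torus_tuples (Suc j)) (\<lambda>u. u(j := 1))"
  proof (rule continuous_on_coordinatewise_then_product)
    show "continuous_on (torus_tuples (Suc j)) (\<lambda>u. (u(j := 1)) i)" for i
      by (cases "i = j") (simp_all add: continuous_on_coordinate)
  qed
  moreover have "continuous_on (torus_tuples (Suc j)) (\<lambda>u. u j)"
    by (rule continuous_on_coordinate)
  moreover have "(fst w)(j := snd w) \<in> torus_tuples (Suc j)" if "w \<in> torus_tuples j \<times> sphere 0 1" for w
    using that by (auto simp: torus_tuples_def circle_tuples_def Suc_le_eq)
  moreover have "(u(j := 1), u j) \<in> torus_tuples j \<times> sphere 0 1" if "u \<in> torus_tuples (Suc j)" for u
    using that by (simp add: torus_tuples_def circle_tuples_def Suc_le_eq)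
  moreover have "(((fst w)(j := snd w))(j := 1), ((fst w)(j := snd w)) j) = w"
    if "w \<in> torus_tuples j \<times> sphere 0 1" for w
  proof -
    have "fst w j = 1"
      using that by (auto simp: torus_tuples_def)
    then show ?thesis
      by (metis fun_upd_same fun_upd_triv fun_upd_upd prod.collapse)
  qed
  ultimately have "homeomorphic_maps (top_of_set (torus_tuples j \<times> sphere 0 1)) (top_of_set (torus_tuples (Suc j)))
       (\<lambda>w. (fst w)(j := snd w)) (\<lambda>u. (u(j := 1), u j))"
    unfolding homeomorphic_maps_def continuous_map_subtopology_eu
    by (intro conjI continuous_on_Pair) (simp_all del: fun_upd_apply)
  then show ?thesis
    unfolding homeomorphic_space_def prod_topology_subtopology_eu by (intro exI)
qed

lemma nontrivial_homology_torus:
  "\<not> trivial_group (homology_group (int j) (top_of_set (torus_tuples j)))"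
proof (induction j)
  case 0
  have "topspace (top_of_set (torus_tuples 0)) = {\<lambda>_. 1}"
    by (auto simp: torus_tuples_def circle_tuples_def)
  then have "homology_group 0 (top_of_set (torus_tuples 0)) \<cong> integer_group"
    by (rule homology_coefficients)
  moreover have "\<not> trivial_group integer_group"
    by (metis UNIV_I carrier_integer_group one_integer_group singletonD trivial_group_def zero_neq_one)
  ultimately show ?case
    using group_relative_homology_group group_integer_group isomorphic_group_triviality by fastforce
next
  case (Suc j)
  have "int j + 1 = int (Suc j)"
    by simp
  then show ?case
    using nontrivial_homology_prod_circle [OF Suc]
      homeomorphic_space_imp_isomorphic_homology_groups [OF torus_Suc_homeomorphic, of "int (Suc j)" j]
      isomorphic_group_triviality group_relative_homology_group by metis
qed

section \<open>Tori of square configurations\<close>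

text \<open>
  \<open>Z k u\<close> is the position of square \<open>k\<close> in the complex plane. The last clause says that the direction of
  \<open>Z a u - Z b u\<close> is never opposite to \<open>u i\<close>, hence homotopic to \<open>u i\<close> along straight lines.
\<close>

definition essential_family :: "nat \<Rightarrow> nat \<Rightarrow> nat \<Rightarrow> nat \<Rightarrow> (nat \<Rightarrow> (nat \<Rightarrow> complex) \<Rightarrow> complex) \<Rightarrow> bool"
  where "essential_family n p q j Z \<longleftrightarrow>
    (\<forall>k<n. continuous_on circle_tuples (Z k)) \<and>
    (\<forall>u\<in>circle_tuples. \<forall>k<n. Re (Z k u) \<in> {1..real p} \<and> Im (Z k u) \<in> {1..real q}) \<and>
    (\<forall>u\<in>circle_tuples. \<forall>k<n. \<forall>l<n. k \<noteq> l \<longrightarrow>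
       1 \<le> \<bar>Re (Z k u - Z l u)\<bar> \<or> 1 \<le> \<bar>Im (Z k u - Z l u)\<bar>) \<and>
    (\<forall>i<j. \<exists>a<n. \<exists>b<n. \<forall>u\<in>circle_tuples. \<forall>s\<ge>0. Z a u - Z b u \<noteq> - complex_of_real s * u i)"

lemma essential_familyD:
  assumes "essential_family n p q j Z"
  shows "k < n \<Longrightarrow> continuous_on circle_tuples (Z k)"
    and "u \<in> circle_tuples \<Longrightarrow> k < n \<Longrightarrow> Re (Z k u) \<in> {1..real p} \<and> Im (Z k u) \<in> {1..real q}"
    and "u \<in> circle_tuples \<Longrightarrow> k < n \<Longrightarrow> l < n \<Longrightarrow> k \<noteq> l \<Longrightarrow>
         1 \<le> \<bar>Re (Z k u - Z l u)\<bar> \<or> 1 \<le> \<bar>Im (Z k u - Z l u)\<bar>"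
    and "i < j \<Longrightarrow> \<exists>a<n. \<exists>b<n. \<forall>u\<in>circle_tuples. \<forall>s\<ge>0. Z a u - Z b u \<noteq> - complex_of_real s * u i"
  using assms unfolding essential_family_def by blast+

definition essential_torus :: "nat \<Rightarrow> nat \<Rightarrow> nat \<Rightarrow> nat \<Rightarrow> bool"
  where "essential_torus n p q j \<longleftrightarrow> Ex (essential_family n p q j)"

text \<open>The family gives a map \<open>f\<close> from the torus to configurations, and
  \<open>g\<close> reads off the unit directions between the chosen pairs. Normalised straight lines
  deform \<open>g \<circ> f\<close> to the identity.\<close>

lemma nontrivial_homology_square_config_space:
  assumes "essential_family n p q j Z"
  shows "\<not> trivial_group (homology_group (int j) (square_config_space n p q))"
proof -
  note cts = essential_familyD(1) [OF assms] and box = essential_familyD(2) [OF assms]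
    and sep = essential_familyD(3) [OF assms] and ess = essential_familyD(4) [OF assms]
  obtain a b where ab: "\<And>i. i < j \<Longrightarrow> a i < n" "\<And>i. i < j \<Longrightarrow> b i < n"
    and ess: "\<And>i u s. i < j \<Longrightarrow> u \<in> circle_tuples \<Longrightarrow> s \<ge> 0 \<Longrightarrow> Z (a i) u - Z (b i) u \<noteq> - complex_of_real s * u i"
    using ess by metis
  \<comment> \<open>Membership in \<open>Euclidean_space\<close> is absorbed as vanishing of the
    coordinates from \<open>2 * n\<close> on, leaving a plain subset of the function space.\<close>
  define P where "P = {z. (\<forall>i\<ge>2 * n. z i = 0) \<and> (\<forall>k<n. 1 \<le> z (2 * k) \<and> z (2 * k) \<le> real p \<and>
                  1 \<le> z (2 * k + 1) \<and> z (2 * k + 1) \<le> real q) \<and>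
           (\<forall>k l. k < l \<and> l < n \<longrightarrow>
                  \<bar>z (2 * k) - z (2 * l)\<bar> \<ge> 1 \<or>
                  \<bar>z (2 * k + 1) - z (2 * l + 1)\<bar> \<ge> 1)}"
  have conf: "square_config_space n p q = top_of_set P"
    unfolding square_config_space_def Euclidean_space_def P_def subtopology_subtopology
      euclidean_product_topology [symmetric]
    by (rule arg_cong2 [where f = subtopology]) auto
  define f where "f = (\<lambda>u i. if i < 2 * n then (if even i then Re (Z (i div 2) u) else Im (Z (i div 2) u)) else 0)"
  define d where "d = (\<lambda>i z. Complex (z (2 * a i) - z (2 * b i)) (z (2 * a i + 1) - z (2 * b i + 1)))"
  define g where "g = (\<lambda>z i. if i < j then sgn (d i z) else 1)"
  have sub: "u \<in> circle_tuples" if "u \<in> torus_tuples j" for u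
    using that by (simp add: torus_tuples_def)
  \<comment> \<open>The case \<open>s = 0\<close>: for equal indices both sides would be
    zero.\<close>
  have neq: "a i \<noteq> b i" if "i < j" for i
    using ess [OF that, of "\<lambda>_. 1" 0] by (auto simp: circle_tuples_def)
  have d0: "d i z \<noteq> 0" if "z \<in> P" "i < j" for i z
  proof -
    have "1 \<le> \<bar>z (2 * k) - z (2 * l)\<bar> \<or> 1 \<le> \<bar>z (2 * k + 1) - z (2 * l + 1)\<bar>"
      if "k < l" "l < n" for k l
      using \<open>z \<in> P\<close> that unfolding P_def by blast
    from this [of "a i" "b i"] this [of "b i" "a i"] show ?thesis
      using neq [OF that(2)] ab [OF that(2)] by (auto simp: d_def complex_eq_iff nat_neq_iff)
  qed
  have f_nth: "f u (2 * k) = Re (Z k u)" "f u (2 * k + 1) = Im (Z k u)" if "k < n" for k u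
    using that by (auto simp: f_def)
  have df: "d i (f u) = Z (a i) u - Z (b i) u" if "i < j" for i u
    using f_nth [OF ab(1) [OF that], of u] f_nth [OF ab(2) [OF that], of u] by (simp add: d_def complex_eq_iff)
  have "continuous_on (torus_tuples j) f"
    unfolding f_def
  proof (rule continuous_on_coordinatewise_then_product)
    fix i
    have Z: "continuous_on (torus_tuples j) (Z (i div 2))" if "i < 2 * n"
      using that sub by (intro continuous_on_subset [OF cts]) auto
    show "continuous_on (torus_tuples j)
        (\<lambda>u. if i < 2 * n then if even i then Re (Z (i div 2) u) else Im (Z (i div 2) u) else 0)"
      by (cases "i < 2 * n"; cases "even i") (simp_all add: Z continuous_on_Re continuous_on_Im)
  qed
  moreover have "f u \<in> P" if "u \<in> torus_tuples j" for u
  proof -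
    have "f u i = 0" if "2 * n \<le> i" for i
      using that by (simp add: f_def)
    moreover have "1 \<le> \<bar>f u (2 * k) - f u (2 * l)\<bar> \<or> 1 \<le> \<bar>f u (2 * k + 1) - f u (2 * l + 1)\<bar>"
      if "k < l" "l < n" for k l
      using sep [OF sub [OF \<open>u \<in> torus_tuples j\<close>], of k l] that f_nth [of k u] f_nth [of l u] by simp
    moreover have "1 \<le> f u (2 * k) \<and> f u (2 * k) \<le> real p \<and> 1 \<le> f u (2 * k + 1) \<and> f u (2 * k + 1) \<le> real q"
      if "k < n" for k
      using box [OF sub [OF \<open>u \<in> torus_tuples j\<close>] that] by (simp only: f_nth [OF that] atLeastAtMost_iff)
    ultimately show ?thesis
      unfolding P_def by blast
  qed
  ultimately have f: "continuous_map (top_of_set (torus_tuples j)) (top_of_set P) f"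
    by (auto simp: continuous_map_in_subtopology)
  have "continuous_on P g"
    unfolding g_def
  proof (rule continuous_on_coordinatewise_then_product)
    have "continuous_on P (d i)" for i
      unfolding d_def Complex_eq by (intro continuous_intros continuous_on_coordinate)
    then show "continuous_on P (\<lambda>z. if i < j then sgn (d i z) else 1)" for i
      using d0 by (cases "i < j") (simp_all add: continuous_on_sgn)
  qed
  moreover have "g z \<in> torus_tuples j" if "z \<in> P" for z
    using d0 [OF that] by (auto simp: g_def torus_tuples_def circle_tuples_def norm_sgn)
  ultimately have g: "continuous_map (top_of_set P) (top_of_set (torus_tuples j)) g"
    by (auto simp: continuous_map_in_subtopology)
  \<comment> \<open>A zero of this segment at time \<open>t < 1\<close> would make the displacement
    equal to \<open>- (t / (1 - t)) * u i\<close>, a forbidden direction.\<close>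
  define v where "v = (\<lambda>w i. (1 - of_real (fst w)) * (Z (a i) (snd w) - Z (b i) (snd w)) + of_real (fst w) * snd w i)"
  have v0: "v w i \<noteq> 0" if "i < j" "w \<in> {0..1} \<times> torus_tuples j" for w i
  proof
    obtain t u where w: "w = (t, u)" "0 \<le> t" "t \<le> 1" and u: "u \<in> circle_tuples"
      using \<open>w \<in> _\<close> sub by auto
    assume eq: "v w i = 0"
    have "norm (u i) = 1"
      using u by (simp add: circle_tuples_def)
    then have "t \<noteq> 1"
      using eq w by (auto simp: v_def)
    with eq w have "Z (a i) u - Z (b i) u = - complex_of_real (t / (1 - t)) * u i"
      by (simp add: v_def field_simps)
    then show False
      using ess [OF \<open>i < j\<close> u, of "t / (1 - t)"] w \<open>t \<noteq> 1\<close> by simp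
  qed
  define h where "h = (\<lambda>w i. if i < j then sgn (v w i) else 1)"
  have "continuous_on ({0..1} \<times> torus_tuples j) h"
    unfolding h_def
  proof (rule continuous_on_coordinatewise_then_product)
    fix i
    have "continuous_on ({0..1} \<times> torus_tuples j) (\<lambda>w. Z k (snd w))" if "k < n" for k
      by (rule continuous_on_compose2 [OF cts [OF that] continuous_on_snd]) (auto simp: sub)
    then have "continuous_on ({0..1} \<times> torus_tuples j) (\<lambda>w. v w i)" if "i < j"
      using ab that unfolding v_def
      by (intro continuous_intros continuous_on_compose2 [OF continuous_on_coordinate [of UNIV] continuous_on_snd]) auto
    then show "continuous_on ({0..1} \<times> torus_tuples j) (\<lambda>w. if i < j then sgn (v w i) else 1)"
      using v0 by (cases "i < j") (simp_all add: continuous_on_sgn)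
  qed
  moreover have "h w \<in> torus_tuples j" if "w \<in> {0..1} \<times> torus_tuples j" for w
    using v0 [OF _ that] by (auto simp: h_def torus_tuples_def circle_tuples_def norm_sgn)
  ultimately have "continuous_map (prod_topology (top_of_set {0..1}) (top_of_set (torus_tuples j)))
      (top_of_set (torus_tuples j)) h"
    by (auto simp: continuous_map_in_subtopology prod_topology_subtopology_eu)
  moreover have "h (0, u) = (g \<circ> f) u" for u
    by (auto simp: h_def g_def v_def df)
  moreover have "h (1, u) = u" if "u \<in> torus_tuples j" for u
    using that by (auto simp: h_def v_def torus_tuples_def circle_tuples_def sgn_div_norm)
  ultimately have "homotopic_with (\<lambda>_. True) (top_of_set (torus_tuples j)) (top_of_set (torus_tuples j)) (g \<circ> f) id"
    by (intro homotopic_with [THEN iffD2] exI [of _ h]) auto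
  from nontrivial_homology_of_homotopy_section [OF f g this nontrivial_homology_torus]
  show ?thesis
    by (simp add: conf)
qed


section \<open>Tilings\<close>

lemma essential_torus_empty: "essential_torus 0 p q 0"
  by (auto simp: essential_torus_def essential_family_def)

lemma essential_torus_unit: "essential_torus 1 1 1 0"
  unfolding essential_torus_def essential_family_def
  by (intro exI [of _ "\<lambda>_ _. 1 + \<i>"]) auto

text \<open>Reflection in the diagonal, \<open>\<tau>\<close>, swaps real and imaginary parts. The
  circle parameters are reflected too, which preserves the condition on directions.\<close>

lemma essential_torus_transpose:
  assumes "essential_torus n p q j"
  shows "essential_torus n q p j"
proof -
  obtain Z where Z: "essential_family n p q j Z"
    using assms by (auto simp: essential_torus_def)
  define \<tau> where "\<tau> = (\<lambda>z. \<i> * cnj z)"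
  define Y where "Y = (\<lambda>k u. \<tau> (Z k (\<tau> \<circ> u)))"
  have \<tau>: "\<tau> \<circ> u \<in> circle_tuples" if "u \<in> circle_tuples" for u
    using that by (simp add: circle_tuples_def \<tau>_def norm_mult)
  have inv: "\<tau> (\<tau> z) = z" for z
    by (simp add: \<tau>_def mult.assoc [symmetric])
  have Re_Y: "Re (Y k u) = Im (Z k (\<tau> \<circ> u))" and Im_Y: "Im (Y k u) = Re (Z k (\<tau> \<circ> u))" for k u
    by (simp_all add: Y_def \<tau>_def)
  have cts: "continuous_on circle_tuples (Y k)" if "k < n" for k
  proof -
    have "continuous_on circle_tuples (\<lambda>u. \<tau> \<circ> u)"
      unfolding \<tau>_def o_def
      by (rule continuous_on_coordinatewise_then_product)
        (intro continuous_on_mult continuous_on_const continuous_on_cnj continuous_on_coordinate)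
    then have "continuous_on circle_tuples (\<lambda>u. Z k (\<tau> \<circ> u))"
      using \<tau> by (intro continuous_on_compose2 [OF essential_familyD(1) [OF Z that]]) auto
    then show ?thesis
      unfolding Y_def \<tau>_def by (intro continuous_on_mult continuous_on_const continuous_on_cnj)
  qed
  have ess: "Y a u - Y b u \<noteq> - complex_of_real s * u i"
    if "Z a (\<tau> \<circ> u) - Z b (\<tau> \<circ> u) \<noteq> - complex_of_real s * (\<tau> \<circ> u) i" for a b u s i
  proof
    assume "Y a u - Y b u = - complex_of_real s * u i"
    then have "\<tau> (Y a u - Y b u) = \<tau> (- complex_of_real s * u i)"
      by simp
    moreover have "\<tau> (Y a u - Y b u) = \<tau> (Y a u) - \<tau> (Y b u)"
      by (simp add: \<tau>_def algebra_simps)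
    moreover have "\<tau> (- complex_of_real s * u i) = - complex_of_real s * \<tau> (u i)"
      by (simp add: \<tau>_def)
    ultimately show False
      using that by (simp add: Y_def inv)
  qed
  have "essential_family n q p j Y"
    unfolding essential_family_def
  proof (intro conjI ballI allI impI)
    fix i assume "i < j"
    then obtain a b where "a < n" "b < n"
        "\<forall>u\<in>circle_tuples. \<forall>s\<ge>0. Z a u - Z b u \<noteq> - complex_of_real s * u i"
      using essential_familyD(4) [OF Z] by blast
    then show "\<exists>a<n. \<exists>b<n. \<forall>u\<in>circle_tuples. \<forall>s\<ge>0. Y a u - Y b u \<noteq> - complex_of_real s * u i"
      using ess \<tau> by blast
  next
    fix u k l assume "u \<in> circle_tuples" "k < n" "l < n" "k \<noteq> l"
    then show "1 \<le> \<bar>Re (Y k u - Y l u)\<bar> \<or> 1 \<le> \<bar>Im (Y k u - Y l u)\<bar>"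
      using essential_familyD(3) [OF Z \<tau>] by (auto simp: Re_Y Im_Y)
  qed (use cts essential_familyD(2) [OF Z \<tau>] in \<open>simp_all add: Re_Y Im_Y\<close>)
  then show ?thesis
    by (auto simp: essential_torus_def)
qed

text \<open>The second box stands to the right of the first and uses the circle coordinates from
  \<open>j\<close> on. Squares of different boxes are separated horizontally: real parts are at most
  \<open>p\<close> on the left and at least \<open>p + 1\<close> on the right.\<close>

lemma essential_torus_juxtapose:
  assumes "essential_torus n p q j" and "essential_torus n' p' q j'"
  shows "essential_torus (n + n') (p + p') q (j + j')"
proof -
  obtain Z Z' where Z: "essential_family n p q j Z" and Z': "essential_family n' p' q j' Z'"
    using assms by (auto simp: essential_torus_def)
  define \<sigma> :: "(nat \<Rightarrow> complex) \<Rightarrow> nat \<Rightarrow> complex" where "\<sigma> = (\<lambda>u i. u (i + j))"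
  define Y where "Y = (\<lambda>k u. if k < n then Z k u else Z' (k - n) (\<sigma> u) + of_nat p)"
  have \<sigma>: "\<sigma> u \<in> circle_tuples" if "u \<in> circle_tuples" for u
    using that by (simp add: circle_tuples_def \<sigma>_def)
  have "continuous_on circle_tuples \<sigma>"
    unfolding \<sigma>_def by (rule continuous_on_coordinatewise_then_product) (rule continuous_on_coordinate)
  then have cts': "continuous_on circle_tuples (\<lambda>u. Z' k (\<sigma> u))" if "k < n'" for k
    using \<sigma> by (intro continuous_on_compose2 [OF essential_familyD(1) [OF Z' that]]) auto
  have Y1: "Y k u = Z k u" if "k < n" for k u
    using that by (simp add: Y_def)
  have Y2: "Y (n + k) u = Z' k (\<sigma> u) + of_nat p" for k u
    by (simp add: Y_def)
  have box: "Re (Z k u) \<in> {1..real p}" "Im (Z k u) \<in> {1..real q}"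
    if "k < n" "u \<in> circle_tuples" for k u
    using essential_familyD(2) [OF Z] that by auto
  have box': "Re (Z' k u) \<in> {1..real p'}" "Im (Z' k u) \<in> {1..real q}"
    if "k < n'" "u \<in> circle_tuples" for k u
    using essential_familyD(2) [OF Z'] that by auto
  have split: "(\<forall>k<n + n'. P k) \<longleftrightarrow> (\<forall>k<n. P k) \<and> (\<forall>k<n'. P (n + k))" for P and n n' :: nat
    by (metis add_diff_inverse_nat nat_add_left_cancel_less trans_less_add1)
  have "\<forall>k<n + n'. continuous_on circle_tuples (Y k)"
    unfolding split
  proof (intro conjI allI impI)
    fix k assume "k < n"
    then show "continuous_on circle_tuples (Y k)"
      using essential_familyD(1) [OF Z] by (simp add: Y_def)
  next
    fix k assume "k < n'"
    then have "continuous_on circle_tuples (\<lambda>u. Z' k (\<sigma> u) + of_nat p)"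
      by (intro continuous_on_add continuous_on_const cts')
    then show "continuous_on circle_tuples (Y (n + k))"
      by (simp add: Y_def)
  qed
  moreover have "\<forall>k<n + n'. Re (Y k u) \<in> {1..real (p + p')} \<and> Im (Y k u) \<in> {1..real q}"
    if u: "u \<in> circle_tuples" for u
    unfolding split using box [OF _ u] box' [OF _ \<sigma> [OF u]] by (force simp: Y1 Y2)
  moreover have "\<forall>k<n + n'. \<forall>l<n + n'. k \<noteq> l \<longrightarrow>
       1 \<le> \<bar>Re (Y k u - Y l u)\<bar> \<or> 1 \<le> \<bar>Im (Y k u - Y l u)\<bar>"
    if u: "u \<in> circle_tuples" for u
  proof -
    have "1 \<le> Re (Z' l (\<sigma> u)) + real p - Re (Z k u)" if "k < n" "l < n'" for k l
      using box(1) [OF that(1) u] box'(1) [OF that(2) \<sigma> [OF u]] by simp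
    then have "1 \<le> \<bar>Re (Y k u - Y (n + l) u)\<bar>" "1 \<le> \<bar>Re (Y (n + l) u - Y k u)\<bar>"
      if "k < n" "l < n'" for k l
      using that by (force simp: Y1 Y2)+
    moreover have "1 \<le> \<bar>Re (Y k u - Y l u)\<bar> \<or> 1 \<le> \<bar>Im (Y k u - Y l u)\<bar>"
      if "k < n" "l < n" "k \<noteq> l" for k l
      using essential_familyD(3) [OF Z u that] that by (simp add: Y1)
    moreover have "1 \<le> \<bar>Re (Y (n + k) u - Y (n + l) u)\<bar> \<or> 1 \<le> \<bar>Im (Y (n + k) u - Y (n + l) u)\<bar>"
      if "k < n'" "l < n'" "k \<noteq> l" for k l
      using essential_familyD(3) [OF Z' \<sigma> [OF u] that] by (simp add: Y2)
    ultimately show ?thesis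
      unfolding split by blast
  qed
  moreover have "\<forall>i<j + j'. \<exists>a<n + n'. \<exists>b<n + n'. \<forall>u\<in>circle_tuples. \<forall>s\<ge>0.
       Y a u - Y b u \<noteq> - complex_of_real s * u i"
    unfolding split [of j j']
  proof (intro conjI allI impI)
    fix i assume "i < j"
    then obtain a b where "a < n" "b < n"
        "\<forall>u\<in>circle_tuples. \<forall>s\<ge>0. Z a u - Z b u \<noteq> - complex_of_real s * u i"
      using essential_familyD(4) [OF Z] by blast
    then show "\<exists>a<n + n'. \<exists>b<n + n'. \<forall>u\<in>circle_tuples. \<forall>s\<ge>0.
       Y a u - Y b u \<noteq> - complex_of_real s * u i"
      by (intro exI [of _ a] exI [of _ b] conjI) (simp_all add: Y1)
  next
    fix i assume "i < j'"
    then obtain a b where ab: "a < n'" "b < n'"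
        "\<forall>u\<in>circle_tuples. \<forall>s\<ge>0. Z' a u - Z' b u \<noteq> - complex_of_real s * u i"
      using essential_familyD(4) [OF Z'] by blast
    have "Y (n + a) u - Y (n + b) u \<noteq> - complex_of_real s * u (j + i)"
      if "u \<in> circle_tuples" "s \<ge> 0" for u s
      using ab(3) \<sigma> [OF that(1)] that(2) unfolding Y2 by (auto simp: \<sigma>_def add.commute [of j i])
    then show "\<exists>a<n + n'. \<exists>b<n + n'. \<forall>u\<in>circle_tuples. \<forall>s\<ge>0.
       Y a u - Y b u \<noteq> - complex_of_real s * u (j + i)"
      using ab by (intro exI [of _ "n + a"] exI [of _ "n + b"] conjI) simp_all
  qed
  ultimately have "essential_family (n + n') (p + p') q (j + j') Y"
    unfolding essential_family_def by blast
  then show ?thesis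
    by (auto simp: essential_torus_def)
qed

lemma essential_torus_row:
  assumes "essential_torus n p q j"
  shows "essential_torus (a * n) (a * p) q (a * j)"
proof (induction a)
  case 0
  then show ?case
    by (simp add: essential_torus_empty)
next
  case (Suc a)
  then show ?case
    using essential_torus_juxtapose [OF assms Suc] by simp
qed

lemma essential_torus_tile:
  assumes "essential_torus n p q j"
  shows "essential_torus (b * (a * n)) (a * p) (b * q) (b * (a * j))"
  using assms by (intro essential_torus_transpose [OF essential_torus_row] essential_torus_transpose
      [OF essential_torus_row [OF assms]])


section \<open>Three clusters of squares\<close>

definition sup_norm :: "complex \<Rightarrow> real"
  where "sup_norm z = max \<bar>Re z\<bar> \<bar>Im z\<bar>"

lemma sup_norm_add: "sup_norm (a + b) \<le> sup_norm a + sup_norm b"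
  by (auto simp: sup_norm_def)

lemma sup_norm_diff: "sup_norm (a - b) \<le> sup_norm a + sup_norm b"
  by (auto simp: sup_norm_def)

lemma sup_norm_mult_of_real: "sup_norm (of_real t * z) = \<bar>t\<bar> * sup_norm z"
  by (auto simp: sup_norm_def abs_mult max_mult_distrib_left)

lemma sup_norm_sum: "(\<And>i. i \<in> A \<Longrightarrow> sup_norm (f i) \<le> r) \<Longrightarrow> sup_norm (sum f A) \<le> real (card A) * r"
proof (induction A rule: infinite_finite_induct)
  case (insert x A)
  have "sup_norm (f x + sum f A) \<le> sup_norm (f x) + sup_norm (sum f A)"
    by (rule sup_norm_add)
  with insert show ?case
    by (force simp: algebra_simps)
qed (simp_all add: sup_norm_def)

text \<open>The factor 2 forces saturation: a point of the unit circle has a coordinate of absolute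
  value at least \<open>1/2\<close>, so for \<open>r = 1\<close> its image lies on the boundary of
  the square.\<close>

definition clamp_square :: "real \<Rightarrow> complex \<Rightarrow> complex"
  where "clamp_square r z = Complex (max (- r) (min r (2 * Re z))) (max (- r) (min r (2 * Im z)))"

lemma sup_norm_clamp_square: "0 \<le> r \<Longrightarrow> sup_norm (clamp_square r z) \<le> r"
  by (auto simp: sup_norm_def clamp_square_def)

lemma continuous_on_clamp_square:
  assumes "continuous_on S f"
  shows "continuous_on S (\<lambda>x. clamp_square r (f x))"
  unfolding clamp_square_def Complex_eq by (intro continuous_intros assms)

text \<open>
  The displacement \<open>d\<close> separates two unit squares along an axis on which it points the same way as \<open>z\<close>.
  This gives disjointness of the squares and the condition on directions at once.
\<close>

definition codirected :: "complex \<Rightarrow> complex \<Rightarrow> bool"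
  where "codirected d z \<longleftrightarrow> 1 \<le> \<bar>Re d\<bar> \<and> 0 < Re d * Re z \<or> 1 \<le> \<bar>Im d\<bar> \<and> 0 < Im d * Im z"

lemma codirected_uminus: "codirected (- d) (- z) \<longleftrightarrow> codirected d z"
  by (simp add: codirected_def)

lemma codirected_separated: "codirected d z \<Longrightarrow> 1 \<le> \<bar>Re d\<bar> \<or> 1 \<le> \<bar>Im d\<bar>"
  by (auto simp: codirected_def)

lemma codirected_not_opposite:
  assumes "codirected d z" "0 \<le> s"
  shows "d \<noteq> - complex_of_real s * z"
proof
  assume "d = - complex_of_real s * z"
  then have "Re d * Re z = - (s * (Re z)\<^sup>2)" "Im d * Im z = - (s * (Im z)\<^sup>2)"
    by (simp_all add: power2_eq_square)
  then have "Re d * Re z \<le> 0" "Im d * Im z \<le> 0"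
    using assms(2) by simp_all
  with assms(1) show False
    by (auto simp: codirected_def)
qed

text \<open>After scaling, the separating coordinate has absolute value at least \<open>r\<close>;
  an error of at most \<open>r - 1\<close> keeps its sign and leaves a gap of at least 1.\<close>

lemma codirected_perturb:
  assumes d: "codirected d z" and r: "1 \<le> r" and e: "sup_norm e \<le> r - 1"
  shows "codirected (of_real r * d + e) z"
proof -
  have *: "1 \<le> \<bar>r * x + y\<bar> \<and> 0 < (r * x + y) * w"
    if x: "1 \<le> \<bar>x\<bar>" "0 < x * w" and y: "\<bar>y\<bar> \<le> r - 1" for x y w
  proof (cases "x > 0")
    case True
    then have "r \<le> r * x" "0 < w"
      using x r by (auto simp: zero_less_mult_iff)
    moreover from this have "1 \<le> r * x + y"
      using y by linarith
    ultimately show ?thesis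
      by simp
  next
    case False
    then have "x \<le> -1" "w < 0"
      using x by (auto simp: zero_less_mult_iff)
    then have "r * x \<le> r * (-1)"
      using r by (intro mult_left_mono) auto
    then have "r * x + y \<le> -1"
      using y by linarith
    then show ?thesis
      using \<open>w < 0\<close> by (auto intro: mult_neg_neg)
  qed
  show ?thesis
    using d * [of "Re d" "Re z" "Re e"] * [of "Im d" "Im z" "Im e"] e
    by (auto simp: codirected_def sup_norm_def)
qed

lemma codirected_clamp_square:
  assumes "norm z = 1"
  shows "codirected (clamp_square 1 z) z"
proof -
  have "(Re z)\<^sup>2 + (Im z)\<^sup>2 = 1"
    using assms by (metis cmod_power2 power_one)
  then have "(1/2)\<^sup>2 \<le> (Re z)\<^sup>2 \<or> (1/2)\<^sup>2 \<le> (Im z)\<^sup>2"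
    by (auto simp: power2_eq_square)
  then have "1/2 \<le> \<bar>Re z\<bar> \<or> 1/2 \<le> \<bar>Im z\<bar>"
    by (simp only: abs_le_square_iff [symmetric]) simp
  moreover have "1 \<le> \<bar>max (-1) (min 1 (2 * x))\<bar> \<and> 0 < max (-1) (min 1 (2 * x)) * x"
    if "1/2 \<le> \<bar>x\<bar>" for x :: real
    using that by (cases "x > 0") (auto simp: min_def max_def zero_less_mult_iff)
  ultimately show ?thesis
    by (auto simp: codirected_def clamp_square_def)
qed

text \<open>
  If \<open>w\<close> is within \<open>45\<close> degrees of the real axis, the two arguments lie within \<open>75\<close> degrees of opposite
  ends of that axis, so their real parts have absolute value at least \<open>1/4\<close> and are clamped to opposite
  signs; otherwise the same holds for the imaginary parts.
\<close>

lemma codirected_clamp_square_diff: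
  assumes w: "norm w = 1"
  shows "codirected (clamp_square (1/2) (cis (pi/6) * w) - clamp_square (1/2) (cis (5*pi/6) * w)) w"
proof -
  define f :: "real \<Rightarrow> real" where "f = (\<lambda>x. max (- (1/2)) (min (1/2) (2 * x)))"
  have f: "1/4 \<le> x \<Longrightarrow> f x = 1/2" "x \<le> -1/4 \<Longrightarrow> f x = - (1/2)" for x
    by (auto simp: f_def)
  have *: "f (sqrt 3 / 2 * c - d / 2) - f (- (sqrt 3 / 2 * c) - d / 2) = sgn c"
    if "\<bar>d\<bar> \<le> \<bar>c\<bar>" "1 \<le> 2 * c\<^sup>2" for c d
  proof -
    \<comment> \<open>The rational bounds for \<open>c\<close> and \<open>sqrt 3\<close> suffice
      because \<open>(172/200 - 1/2) * 7/10 = 0.252\<close> exceeds \<open>1/4\<close>.\<close>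
    have c: "7/10 \<le> \<bar>c\<bar>"
    proof -
      have "(7/10)\<^sup>2 \<le> c\<^sup>2"
        using that(2) by (simp add: power2_eq_square)
      then show ?thesis
        by (simp flip: abs_le_square_iff)
    qed
    have s: "172/100 \<le> sqrt 3"
      by (rule real_le_rsqrt) (simp add: power2_eq_square)
    show ?thesis
    proof (cases "c > 0")
      case True
      then have "172/100 * c \<le> sqrt 3 * c"
        using s by (intro mult_right_mono) auto
      then have "1/4 \<le> sqrt 3 / 2 * c - d / 2" "- (sqrt 3 / 2 * c) - d / 2 \<le> -1/4"
        using that(1) c True by linarith+
      then have "f (sqrt 3 / 2 * c - d / 2) = 1/2" "f (- (sqrt 3 / 2 * c) - d / 2) = - (1/2)"
        by - (rule f; assumption)+
      then show ?thesis
        using True by simp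
    next
      case False
      then have "sqrt 3 * c \<le> 172/100 * c"
        using s by (intro mult_right_mono_neg) auto
      then have "sqrt 3 / 2 * c - d / 2 \<le> -1/4" "1/4 \<le> - (sqrt 3 / 2 * c) - d / 2"
        using that(1) c False by linarith+
      then have "f (sqrt 3 / 2 * c - d / 2) = - (1/2)" "f (- (sqrt 3 / 2 * c) - d / 2) = 1/2"
        by - (rule f; assumption)+
      then show ?thesis
        using False c by (simp add: sgn_if)
    qed
  qed
  have cos5: "cos (5*pi/6) = - (sqrt 3 / 2)" "sin (5*pi/6) = 1/2"
    using cos_pi_minus [of "pi/6"] sin_pi_minus [of "pi/6"] by (simp_all add: cos_30 sin_30)
  define c d where "c = Re w" and "d = Im w"
  have cd: "c\<^sup>2 + d\<^sup>2 = 1"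
    using w by (metis c_def d_def cmod_power2 power_one)
  have D: "clamp_square (1/2) (cis (pi/6) * w) - clamp_square (1/2) (cis (5*pi/6) * w)
    = Complex (f (sqrt 3 / 2 * c - d / 2) - f (- (sqrt 3 / 2 * c) - d / 2))
              (f (sqrt 3 / 2 * d + c / 2) - f (- (sqrt 3 / 2 * d) + c / 2))"
    by (simp add: clamp_square_def f_def c_def d_def cos5 cos_30 sin_30 complex_eq_iff)
  show ?thesis
  proof (cases "\<bar>d\<bar> \<le> \<bar>c\<bar>")
    case True
    then have "d\<^sup>2 \<le> c\<^sup>2"
      by (simp add: abs_le_square_iff)
    with cd have "1 \<le> 2 * c\<^sup>2"
      by simp
    then have "Re (clamp_square (1/2) (cis (pi/6) * w) - clamp_square (1/2) (cis (5*pi/6) * w)) = sgn c" "c \<noteq> 0"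
      using * [OF True] by (auto simp: D)
    then show ?thesis
      unfolding codirected_def c_def [symmetric] by (auto simp: zero_less_mult_iff)
  next
    case False
    then have "c\<^sup>2 \<le> d\<^sup>2"
      by (simp add: abs_le_square_iff)
    with cd have "1 \<le> 2 * d\<^sup>2"
      by simp
    \<comment> \<open>The imaginary part is the same expression with \<open>(d, - c)\<close> in
      place of \<open>(c, d)\<close>.\<close>
    then have "Im (clamp_square (1/2) (cis (pi/6) * w) - clamp_square (1/2) (cis (5*pi/6) * w)) = sgn d" "d \<noteq> 0"
      using * [of "- c" d] False by (auto simp: D)
    then show ?thesis
      unfolding codirected_def d_def [symmetric] by (auto simp: zero_less_mult_iff)
  qed
qed

text \<open>Three unit vectors 120 degrees apart, clamped. As
  \<open>cis (pi/6) - cis (5*pi/6)\<close> is a positive real, the offset \<open>pi/6\<close> makes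
  the unclamped difference of corners \<open>0\<close> and \<open>1\<close> point along
  \<open>w\<close>.\<close>

definition corner :: "nat \<Rightarrow> complex \<Rightarrow> complex"
  where "corner c w = clamp_square (1/2) (cis (pi/6 + 2 * pi / 3 * real c) * w)"

lemma codirected_corner_diff:
  assumes "norm w = 1"
  shows "codirected (corner c w - corner (Suc c) w) (cis (2 * pi / 3 * real c) * w)"
proof -
  have "cis (5*pi/6) * cis (2 * pi / 3 * real c) = cis (pi/6 + 2 * pi / 3 * real (Suc c))"
    by (simp add: cis_mult field_simps)
  moreover have "cis (pi/6) * cis (2 * pi / 3 * real c) = cis (pi/6 + 2 * pi / 3 * real c)"
    by (simp add: cis_mult)
  ultimately show ?thesis
    using codirected_clamp_square_diff [of "cis (2 * pi / 3 * real c) * w"] assms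
    by (simp add: corner_def norm_mult mult.assoc [symmetric])
qed

lemma corner_period: "corner (c + 3) w = corner c w"
proof -
  have "pi / 6 + 2 * pi / 3 * real (c + 3) = (pi / 6 + 2 * pi / 3 * real c) + 2 * pi"
    by (simp add: field_simps)
  then have "cis (pi / 6 + 2 * pi / 3 * real (c + 3)) = cis (pi / 6 + 2 * pi / 3 * real c)"
    by (simp only: cis_mult [symmetric] cis_2pi mult_1_right)
  then show ?thesis
    by (simp add: corner_def)
qed

text \<open>Any two of three cyclic indices are neighbours, so up to sign the difference is one of
  the three consecutive ones.\<close>

lemma codirected_corners:
  assumes "norm w = 1" "c < 3" "c' < 3" "c \<noteq> c'"
  shows "\<exists>v. codirected (corner c w - corner c' w) v"
proof -
  have c0: "corner 3 w = corner 0 w"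
    using corner_period [of 0 w] by simp
  have step: "\<exists>v. codirected (corner c w - corner (Suc c) w) v" for c
    using codirected_corner_diff [OF assms(1)] by blast
  have flip: "\<exists>v. codirected (corner a w - corner b w) v" if "\<exists>v. codirected (corner b w - corner a w) v" for a b
    using that codirected_uminus by (metis minus_diff_eq)
  have "c \<in> {0, 1, 2}" "c' \<in> {0, 1, 2}"
    using assms by auto
  then show ?thesis
    using assms(4) step [of 0] step [of 1] step [of 2] flip [of 0 1] flip [of 1 2] flip [of 2 0] c0
    by (auto simp: numeral_3_eq_3 numeral_2_eq_2)
qed

text \<open>
  Square \<open>s\<close> is member \<open>s div 3\<close> of cluster \<open>s mod 3\<close>. Coordinate \<open>0\<close> of the torus moves the clusters, and
  coordinate \<open>s - 2\<close>, for \<open>s \<ge> 3\<close>, turns square \<open>s\<close> around the earlier members of its cluster. With the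
  centre of the cluster as origin, the orbit of member \<open>m\<close> moves that square by \<open>m/2\<close> in its direction and
  all members \<open>l < m\<close> by \<open>1/2\<close> in the opposite direction. For \<open>m = 0\<close> the index \<open>3 * m + c - 2\<close> is
  truncated to \<open>0\<close>, which is harmless as the coefficient vanishes.
\<close>

context
  fixes k :: nat
  assumes k: "1 \<le> k"
begin

definition orbit_dir :: "(nat \<Rightarrow> complex) \<Rightarrow> nat \<Rightarrow> nat \<Rightarrow> complex"
  where "orbit_dir u c i = clamp_square 1 (u (3 * i + c - 2))"

definition in_cluster :: "(nat \<Rightarrow> complex) \<Rightarrow> nat \<Rightarrow> nat \<Rightarrow> complex"
  where "in_cluster u c m = of_real (real m / 2) * orbit_dir u c m
    - of_real (1/2) * (\<Sum>i\<in>{m<..<k}. orbit_dir u c i)"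

text \<open>The offset \<open>real k + 1/2\<close> is the midpoint of the admissible range from
  \<open>1\<close> to \<open>2 * real k\<close>.\<close>

definition cluster_square :: "nat \<Rightarrow> (nat \<Rightarrow> complex) \<Rightarrow> complex"
  where "cluster_square s u = of_real (real k + 1/2) * (1 + \<i>)
    + (of_real (real k) * corner (s mod 3) (u 0) + in_cluster u (s mod 3) (s div 3))"

lemma sup_norm_orbit_dir: "sup_norm (orbit_dir u c i) \<le> 1"
  by (simp add: orbit_dir_def sup_norm_clamp_square)

text \<open>Member \<open>m\<close> moves by at most \<open>m/2\<close> in its own orbit and
  \<open>1/2\<close> in each of the \<open>k - 1 - m\<close> later ones. Its unit square thus stays
  in the \<open>k\<close> by \<open>k\<close> box of the cluster.\<close>

lemma sup_norm_in_cluster: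
  assumes "m < k"
  shows "sup_norm (in_cluster u c m) \<le> (real k - 1) / 2"
proof -
  have "sup_norm (in_cluster u c m) \<le> sup_norm (of_real (real m / 2) * orbit_dir u c m)
      + sup_norm (of_real (1/2) * (\<Sum>i\<in>{m<..<k}. orbit_dir u c i))"
    unfolding in_cluster_def by (rule sup_norm_diff)
  also have "\<dots> = real m / 2 * sup_norm (orbit_dir u c m)
      + 1/2 * sup_norm (\<Sum>i\<in>{m<..<k}. orbit_dir u c i)"
    by (simp add: sup_norm_mult_of_real del: of_real_divide)
  also have "\<dots> \<le> real m / 2 * 1 + 1/2 * (real (card {m<..<k}) * 1)"
    by (intro add_mono mult_left_mono sup_norm_sum sup_norm_orbit_dir) auto
  also have "\<dots> = (real k - 1) / 2"
    using assms by (simp add: of_nat_diff field_simps)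
  finally show ?thesis .
qed

text \<open>Orbits later than \<open>m\<close> move both squares alike and cancel. Orbit
  \<open>m\<close> contributes \<open>m/2\<close> from one square and \<open>1/2\<close> from the
  other; the remainder is the error for \<open>codirected_perturb\<close>.\<close>

lemma in_cluster_diff:
  assumes "l < m" "m < k"
  shows "in_cluster u c m - in_cluster u c l = of_real ((real m + 1) / 2) * orbit_dir u c m
    + (of_real (1/2) * (\<Sum>i\<in>{l<..<m}. orbit_dir u c i) - of_real (real l / 2) * orbit_dir u c l)"
proof -
  have "{l<..<k} = {l<..<m} \<union> {m<..<k} \<union> {m}"
    using assms by auto
  then have "(\<Sum>i\<in>{l<..<k}. orbit_dir u c i)
      = (\<Sum>i\<in>{l<..<m}. orbit_dir u c i) + (\<Sum>i\<in>{m<..<k}. orbit_dir u c i) + orbit_dir u c m"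
    by (subst sum.union_disjoint [symmetric]) (auto simp: sum.union_disjoint)
  then show ?thesis
    by (simp add: in_cluster_def field_simps)
qed

lemma codirected_same_cluster:
  assumes u: "u \<in> circle_tuples" and st: "t mod 3 = s mod 3" "t < s" "s < 3 * k"
  shows "codirected (cluster_square s u - cluster_square t u) (u (s - 2))"
proof -
  define c l m where "c = s mod 3" and "l = t div 3" and "m = s div 3"
  have s: "3 * m + c = s"
    by (simp add: c_def m_def)
  have t: "3 * l + c = t"
    by (simp add: c_def l_def st(1) [symmetric])
  have lm: "l < m" "m < k"
    using s t st by auto
  let ?e = "of_real (1/2) * (\<Sum>i\<in>{l<..<m}. orbit_dir u c i) - of_real (real l / 2) * orbit_dir u c l"
  have "sup_norm ?e \<le> sup_norm (of_real (1/2) * (\<Sum>i\<in>{l<..<m}. orbit_dir u c i))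
      + sup_norm (of_real (real l / 2) * orbit_dir u c l)"
    by (rule sup_norm_diff)
  also have "\<dots> = 1/2 * sup_norm (\<Sum>i\<in>{l<..<m}. orbit_dir u c i) + real l / 2 * sup_norm (orbit_dir u c l)"
    by (simp add: sup_norm_mult_of_real del: of_real_divide)
  also have "\<dots> \<le> 1/2 * (real (card {l<..<m}) * 1) + real l / 2 * 1"
    by (intro add_mono mult_left_mono sup_norm_sum sup_norm_orbit_dir) auto
  \<comment> \<open>The count \<open>(m - l - 1)/2 + l/2\<close> is exactly the error that the
    factor \<open>(m + 1)/2\<close> tolerates.\<close>
  also have "\<dots> = (real m + 1) / 2 - 1"
    using lm by (simp add: field_simps)
  finally have "sup_norm ?e \<le> (real m + 1) / 2 - 1" .
  moreover have "codirected (orbit_dir u c m) (u (s - 2))"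
    unfolding orbit_dir_def s using u by (intro codirected_clamp_square) (simp add: circle_tuples_def)
  moreover have "cluster_square s u - cluster_square t u = of_real ((real m + 1) / 2) * orbit_dir u c m + ?e"
    using in_cluster_diff [OF lm, of u c] by (simp add: cluster_square_def st(1) c_def l_def m_def)
  ultimately show ?thesis
    using lm by (simp only:) (intro codirected_perturb; simp)
qed

text \<open>Scaling the corners by \<open>k\<close> tolerates an error of \<open>k - 1\<close>, and
  each of the two clusters contributes at most half of that.\<close>

lemma codirected_distinct_clusters:
  assumes v: "codirected (corner (s mod 3) (u 0) - corner (t mod 3) (u 0)) v" and st: "s < 3 * k" "t < 3 * k"
  shows "codirected (cluster_square s u - cluster_square t u) v"
proof -
  let ?P = "\<lambda>s. in_cluster u (s mod 3) (s div 3)"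
  have "s div 3 < k" "t div 3 < k"
    using st by auto
  then have "sup_norm (?P s - ?P t) \<le> real k - 1"
    using sup_norm_in_cluster [of "s div 3" u "s mod 3"] sup_norm_in_cluster [of "t div 3" u "t mod 3"]
      sup_norm_diff [of "?P s" "?P t"] by simp
  then have "codirected (of_real (real k) * (corner (s mod 3) (u 0) - corner (t mod 3) (u 0)) + (?P s - ?P t)) v"
    using k by (intro codirected_perturb v) auto
  moreover have "of_real (real k) * (corner (s mod 3) (u 0) - corner (t mod 3) (u 0)) + (?P s - ?P t)
      = cluster_square s u - cluster_square t u"
    by (simp add: cluster_square_def algebra_simps)
  ultimately show ?thesis
    by simp
qed

lemma continuous_on_cluster_square: "continuous_on circle_tuples (cluster_square s)"
  unfolding cluster_square_def in_cluster_def orbit_dir_def corner_def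
  by (intro continuous_on_add continuous_on_diff continuous_on_mult continuous_on_const continuous_on_sum
      continuous_on_clamp_square continuous_on_coordinate)

lemma cluster_square_bounds:
  assumes "s < 3 * k"
  shows "Re (cluster_square s u) \<in> {1..2 * real k}" "Im (cluster_square s u) \<in> {1..2 * real k}"
proof -
  let ?e = "of_real (real k) * corner (s mod 3) (u 0) + in_cluster u (s mod 3) (s div 3)"
  have "sup_norm ?e \<le> sup_norm (of_real (real k) * corner (s mod 3) (u 0))
      + sup_norm (in_cluster u (s mod 3) (s div 3))"
    by (rule sup_norm_add)
  also have "\<dots> \<le> real k * (1/2) + (real k - 1) / 2"
    unfolding sup_norm_mult_of_real corner_def using assms
    by (intro add_mono mult_mono sup_norm_clamp_square sup_norm_in_cluster) (auto simp: sup_norm_def)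
  finally have "sup_norm ?e \<le> real k - 1/2"
    by (simp add: field_simps)
  then have "\<bar>Re ?e\<bar> \<le> real k - 1/2" "\<bar>Im ?e\<bar> \<le> real k - 1/2"
    by (simp_all add: sup_norm_def)
  moreover have "Re (cluster_square s u) = real k + 1/2 + Re ?e" "Im (cluster_square s u) = real k + 1/2 + Im ?e"
    by (simp_all add: cluster_square_def)
  ultimately show "Re (cluster_square s u) \<in> {1..2 * real k}" "Im (cluster_square s u) \<in> {1..2 * real k}"
    by (simp_all only: atLeastAtMost_iff abs_le_iff) linarith+
qed

text \<open>Circle \<open>0\<close> is read off from squares \<open>0\<close> and \<open>1\<close>,
  one from each of two clusters. Circle \<open>i > 0\<close> is read off from square
  \<open>i + 2\<close> and the first member of its cluster.\<close>

lemma essential_family_clusters: "essential_family (3 * k) (2 * k) (2 * k) (3 * k - 2) cluster_square"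
  unfolding essential_family_def
proof (intro conjI ballI allI impI)
  fix u s t assume u: "u \<in> circle_tuples" and st: "s < 3 * k" "t < 3 * k" "s \<noteq> t"
  have "\<exists>v. codirected (cluster_square s u - cluster_square t u) v"
  proof (cases "s mod 3 = t mod 3")
    case True
    with st consider "t < s" | "s < t"
      by linarith
    then show ?thesis
    proof cases
      case 1
      then show ?thesis
        using codirected_same_cluster [OF u _ 1] True st by auto
    next
      case 2
      then show ?thesis
        using codirected_same_cluster [OF u _ 2] True st codirected_uminus by (metis minus_diff_eq)
    qed
  next
    case False
    then obtain v where "codirected (corner (s mod 3) (u 0) - corner (t mod 3) (u 0)) v"
      using codirected_corners [of "u 0" "s mod 3" "t mod 3"] u by (auto simp: circle_tuples_def)
    then show ?thesis
      using codirected_distinct_clusters st by blast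
  qed
  then show "1 \<le> \<bar>Re (cluster_square s u - cluster_square t u)\<bar> \<or> 1 \<le> \<bar>Im (cluster_square s u - cluster_square t u)\<bar>"
    using codirected_separated by blast
next
  fix i assume i: "i < 3 * k - 2"
  show "\<exists>a<3 * k. \<exists>b<3 * k. \<forall>u\<in>circle_tuples. \<forall>s\<ge>0.
      cluster_square a u - cluster_square b u \<noteq> - complex_of_real s * u i"
  proof (cases "i = 0")
    case True
    have "codirected (cluster_square 0 u - cluster_square 1 u) (u 0)" if "u \<in> circle_tuples" for u
      using codirected_corner_diff [of "u 0" 0] that k
      by (intro codirected_distinct_clusters) (auto simp: circle_tuples_def)
    then have "\<forall>u\<in>circle_tuples. \<forall>s\<ge>0. cluster_square 0 u - cluster_square 1 u \<noteq> - complex_of_real s * u i"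
      using True codirected_not_opposite by blast
    moreover have "0 < 3 * k" "1 < 3 * k"
      using k by auto
    ultimately show ?thesis
      by blast
  next
    case False
    have "codirected (cluster_square (i + 2) u - cluster_square ((i + 2) mod 3) u) (u (i + 2 - 2))"
      if "u \<in> circle_tuples" for u
    proof (rule codirected_same_cluster [OF that])
      show "(i + 2) mod 3 < i + 2"
        using False by (intro less_le_trans [OF mod_less_divisor]) auto
    qed (use i in auto)
    then have "\<forall>u\<in>circle_tuples. \<forall>s\<ge>0.
        cluster_square (i + 2) u - cluster_square ((i + 2) mod 3) u \<noteq> - complex_of_real s * u i"
      using codirected_not_opposite by (metis add_diff_cancel_right')
    moreover have "i + 2 < 3 * k" "(i + 2) mod 3 < 3 * k"
      using i k mod_less_divisor [of 3 "i + 2"] by linarith+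
    ultimately show ?thesis
      by blast
  qed
qed (use cluster_square_bounds continuous_on_cluster_square in auto)

end


section \<open>Rational points of the hull\<close>

lemma nonneg_rat_common_denominator:
  fixes a b c :: real
  assumes "a \<in> \<rat>" "b \<in> \<rat>" "c \<in> \<rat>" "0 \<le> a" "0 \<le> b" "0 \<le> c"
  obtains k l m d :: nat where "0 < d" "a = real k / real d" "b = real l / real d" "c = real m / real d"
proof -
  obtain a1 a2 b1 b2 c1 c2 :: nat where *: "a2 \<noteq> 0" "b2 \<noteq> 0" "c2 \<noteq> 0"
      "a = real a1 / real a2" "b = real b1 / real b2" "c = real c1 / real c2"
    using assms by (metis Rats_abs_nat_div_natE abs_of_nonneg)
  show thesis
    by (rule that [of "a2 * b2 * c2" "a1 * b2 * c2" "b1 * a2 * c2" "c1 * a2 * b2"]) (use * in auto)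
qed

text \<open>A row of square blocks of common side \<open>4 * k * l\<close>: \<open>a\<close> tiled
  by cluster boxes of side \<open>2 * k\<close>, \<open>b\<close> by those of side
  \<open>2 * l\<close>, \<open>c\<close> full and \<open>e\<close> empty.\<close>

lemma essential_torus_mixture:
  fixes k l a b c e :: nat
  assumes "1 \<le> k" "1 \<le> l"
  shows "essential_torus (a * (2 * l * (2 * l * (3 * k))) + b * (2 * k * (2 * k * (3 * l))) + c * (4 * k * l * (4 * k * l)))
    ((a + b + c + e) * (4 * k * l)) (4 * k * l)
    (a * (2 * l * (2 * l * (3 * k - 2))) + b * (2 * k * (2 * k * (3 * l - 2))))"
proof -
  have 1: "essential_torus (a * (2 * l * (2 * l * (3 * k)))) (a * (2 * l * (2 * k))) (2 * l * (2 * k))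
     (a * (2 * l * (2 * l * (3 * k - 2))))"
    using assms essential_family_clusters [of k]
    by (intro essential_torus_row essential_torus_tile) (auto simp: essential_torus_def)
  have 2: "essential_torus (b * (2 * k * (2 * k * (3 * l)))) (b * (2 * k * (2 * l))) (2 * k * (2 * l))
     (b * (2 * k * (2 * k * (3 * l - 2))))"
    using assms essential_family_clusters [of l]
    by (intro essential_torus_row essential_torus_tile) (auto simp: essential_torus_def)
  have 3: "essential_torus (c * (4 * k * l * (4 * k * l * 1))) (c * (4 * k * l * 1)) (4 * k * l * 1)
     (c * (4 * k * l * (4 * k * l * 0)))"
    by (intro essential_torus_row essential_torus_tile essential_torus_unit)
  have eq: "2 * l * (2 * k) = 4 * k * l" "2 * k * (2 * l) = 4 * k * l"
    by simp_all
  show ?thesis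
    using essential_torus_juxtapose [OF essential_torus_juxtapose [OF essential_torus_juxtapose
        [OF 1 [unfolded eq] 2 [unfolded eq]] 3 [unfolded mult_1_right]] essential_torus_empty [of "e * (4 * k * l)"]]
    by (simp add: distrib_right)
qed

text \<open>Over a common denominator \<open>D\<close> the weights count blocks among
  \<open>D\<close> equal ones, with the rest left empty, so the densities of squares and of circles
  are the weighted means.\<close>

lemma essential_torus_of_weights:
  fixes x y a b c :: real and k l :: nat
  assumes "1 \<le> k" "1 \<le> l" and rat: "a \<in> \<rat>" "b \<in> \<rat>" "c \<in> \<rat>" and nonneg: "0 \<le> a" "0 \<le> b" "0 \<le> c"
    and le1: "a + b + c \<le> 1" and "x \<le> 1"
    and x: "x = a * (3 / (4 * real k)) + b * (3 / (4 * real l)) + c"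
    and y: "y = a * ((3 * real k - 2) / (4 * (real k)\<^sup>2)) + b * ((3 * real l - 2) / (4 * (real l)\<^sup>2))"
  shows "\<exists>n p q j :: nat. p \<ge> 1 \<and> q \<ge> 1 \<and> n \<le> p * q \<and>
           x = real n / real (p * q) \<and> y = real j / real (p * q) \<and> essential_torus n p q j"
proof -
  obtain A B C D :: nat where D: "0 < D" and abc: "a = real A / real D" "b = real B / real D" "c = real C / real D"
    using nonneg_rat_common_denominator [OF rat nonneg] .
  have "real A + real B + real C \<le> real D"
    using le1 D by (simp add: abc add_divide_distrib [symmetric])
  then obtain E where E: "D = A + B + C + E"
    by (metis le_Suc_ex of_nat_add of_nat_le_iff)
  define p q where "p = D * (4 * k * l)" and "q = 4 * k * l"
  define n where "n = A * (2 * l * (2 * l * (3 * k))) + B * (2 * k * (2 * k * (3 * l))) + C * (4 * k * l * (4 * k * l))"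
  define j where "j = A * (2 * l * (2 * l * (3 * k - 2))) + B * (2 * k * (2 * k * (3 * l - 2)))"
  have pos: "real k > 0" "real l > 0" "real D > 0"
    using assms D by auto
  have pq: "p \<ge> 1" "q \<ge> 1"
    using assms D by (auto simp: p_def q_def Suc_le_eq)
  have xn: "x = real n / real (p * q)"
    using pos by (simp add: x abc n_def p_def q_def field_simps power2_eq_square)
  have kl: "real (3 * k - 2) = 3 * real k - 2" "real (3 * l - 2) = 3 * real l - 2"
    using assms by simp_all
  have yj: "y = real j / real (p * q)"
    unfolding j_def of_nat_add of_nat_mult kl p_def q_def y abc
    using pos by (simp add: field_simps power2_eq_square)
  have "real n \<le> real (p * q)"
    using \<open>x \<le> 1\<close> pq unfolding xn by (subst (asm) divide_le_eq_1_pos) auto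
  then have "n \<le> p * q"
    by linarith
  moreover have "essential_torus n p q j"
    unfolding n_def p_def q_def j_def E by (rule essential_torus_mixture) (use assms in auto)
  ultimately show ?thesis
    using pq xn yj by blast
qed

section \<open>Linear bounds on the hull and the choice of weights\<close>

lemma convex_hull_below_line:
  fixes m c :: real
  assumes "\<And>x y. (x, y) \<in> S \<Longrightarrow> y \<le> m * x + c" and "(x, y) \<in> convex hull S"
  shows "y \<le> m * x + c"
proof -
  have "convex hull S \<subseteq> {z. inner (- m, 1) z \<le> c}"
    using assms(1) by (intro hull_minimal convex_halfspace_le) (force simp: algebra_simps)
  then show ?thesis
    using assms(2) by (auto simp: algebra_simps)
qed

text \<open>The line \<open>y = x\<close> is the tangent at the origin, \<open>y = 1 - x\<close>
  joins \<open>(3/4, 1/4)\<close> to \<open>(1, 0)\<close>, and the last bound is the chord through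
  the parabola points with parameters \<open>k\<close> and \<open>Suc k\<close>.\<close>

lemma convex_hull_parabola_base:
  fixes x y :: real
  defines "v \<equiv> \<lambda>i::nat. 3 / (4 * real i)"
  assumes xy: "(x, y) \<in> convex hull (parabola_points \<union> base_segment)"
  shows "0 \<le> y" "y \<le> x" "y \<le> 1 - x"
    and "\<And>k. 1 \<le> k \<Longrightarrow> y \<le> (1 - 8/9 * (v k + v (Suc k))) * x + 8/9 * v k * v (Suc k)"
proof -
  have mono: "v i \<le> v i'" if "1 \<le> i'" "i' \<le> i" for i i'
    using that by (auto simp: v_def field_simps)
  have v: "0 < v i" "v i \<le> 3/4" if "1 \<le> i" for i
    using that by (auto simp: v_def field_simps)
  have points: "P a b" if "(a, b) \<in> parabola_points \<union> base_segment"
    and V: "\<And>i. 1 \<le> i \<Longrightarrow> P (v i) (v i - 8/9 * (v i)\<^sup>2)"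
    and B: "\<And>a. 0 \<le> a \<Longrightarrow> a \<le> 1 \<Longrightarrow> P a 0" for a b and P :: "real \<Rightarrow> real \<Rightarrow> bool"
    using that(1)
  proof
    assume "(a, b) \<in> parabola_points"
    then obtain i :: int where i: "i \<ge> 1" "a = 3 / (4 * of_int i)" "b = a - 8/9 * a\<^sup>2"
      unfolding parabola_points_def by blast
    moreover from this have "a = v (nat i)"
      by (simp add: v_def)
    ultimately show ?thesis
      using V [of "nat i"] by simp
  next
    assume "(a, b) \<in> base_segment"
    then show ?thesis
      using B by (auto simp: base_segment_def)
  qed
  have "convex hull (parabola_points \<union> base_segment) \<subseteq> {z. inner (0, -1) z \<le> 0}"
  proof (intro hull_minimal convex_halfspace_le subsetI)
    fix z assume "z \<in> parabola_points \<union> base_segment"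
    then have "(fst z, snd z) \<in> parabola_points \<union> base_segment"
      by simp
    then have "0 \<le> snd z"
    proof (rule points)
      fix i :: nat assume "1 \<le> i"
      then have "(v i)\<^sup>2 \<le> v i * (3/4)"
        using v [of i] by (simp add: power2_eq_square)
      then show "0 \<le> v i - 8/9 * (v i)\<^sup>2"
        using v [OF \<open>1 \<le> i\<close>] by simp
    qed simp
    then show "z \<in> {z. inner (0, -1) z \<le> 0}"
      by (simp add: inner_prod_def)
  qed
  then show "0 \<le> y"
    using xy by auto
  have "y \<le> 1 * x + 0"
    using _ xy by (rule convex_hull_below_line) (erule points; simp)
  then show "y \<le> x"
    by simp
  have "y \<le> (-1) * x + 1"
    using _ xy
  proof (rule convex_hull_below_line)
    fix a b assume "(a, b) \<in> parabola_points \<union> base_segment"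
    then show "b \<le> (-1) * a + 1"
    proof (rule points)
      fix i :: nat assume "1 \<le> i"
      \<comment> \<open>Up to the factor \<open>8/9\<close>, this product is the line minus the
        parabola.\<close>
      then have "0 \<le> (3/4 - v i) * (3/2 - v i)"
        using v [of i] by (intro mult_nonneg_nonneg) auto
      then show "v i - 8/9 * (v i)\<^sup>2 \<le> (-1) * v i + 1"
        by (simp add: power2_eq_square algebra_simps)
    qed simp
  qed
  then show "y \<le> 1 - x"
    by simp
  fix k :: nat assume k: "1 \<le> k"
  show "y \<le> (1 - 8/9 * (v k + v (Suc k))) * x + 8/9 * v k * v (Suc k)"
    using _ xy
  proof (rule convex_hull_below_line)
    fix a b assume "(a, b) \<in> parabola_points \<union> base_segment"
    then show "b \<le> (1 - 8/9 * (v k + v (Suc k))) * a + 8/9 * v k * v (Suc k)"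
    proof (rule points)
      fix i :: nat assume i: "1 \<le> i"
      \<comment> \<open>Times \<open>8/9\<close> this is the chord minus the parabola; no
        \<open>v i\<close> lies strictly between the consecutive values.\<close>
      have "0 \<le> (v i - v k) * (v i - v (Suc k))"
      proof (cases "i \<le> k")
        case True
        then show ?thesis
          using i mono [of i k] mono [of i "Suc k"] by (intro mult_nonneg_nonneg) auto
      next
        case False
        then show ?thesis
          using k mono [of k i] mono [of "Suc k" i] by (intro mult_nonpos_nonpos) auto
      qed
      then show "v i - 8/9 * (v i)\<^sup>2 \<le> (1 - 8/9 * (v k + v (Suc k))) * v i + 8/9 * v k * v (Suc k)"
        by (simp add: power2_eq_square algebra_simps)
    next
      fix a :: real assume "0 \<le> a"
      \<comment> \<open>With \<open>v k \<le> 3/4\<close> and \<open>v 2 = 3/8\<close>, the chord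
        has nonnegative slope, so it stays above the base.\<close>
      have "v (Suc k) \<le> v 2"
        using k by (intro mono) auto
      then have "8/9 * (v k + v (Suc k)) \<le> 1"
        using v [OF k] by (simp add: v_def)
      then show "0 \<le> (1 - 8/9 * (v k + v (Suc k))) * a + 8/9 * v k * v (Suc k)"
        using \<open>0 \<le> a\<close> v [OF k] v [of "Suc k"] by simp
    qed
  qed
qed

text \<open>A point of the hull is a convex combination of the point of \<open>base_segment\<close> below it and the
  point above it on the chord joining two consecutive points of the parabola; this keeps all weights rational.\<close>
lemma rational_weights:
  fixes x y :: real
  assumes rat: "x \<in> \<rat>" "y \<in> \<rat>"
    and xy: "(x, y) \<in> convex hull (parabola_points \<union> base_segment)"
  obtains k l :: nat and a b c :: real
  where "1 \<le> k" "1 \<le> l" "a \<in> \<rat>" "b \<in> \<rat>" "c \<in> \<rat>" "0 \<le> a" "0 \<le> b" "0 \<le> c" "a + b + c \<le> 1"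
    "x = a * (3 / (4 * real k)) + b * (3 / (4 * real l)) + c"
    "y = a * ((3 * real k - 2) / (4 * (real k)\<^sup>2)) + b * ((3 * real l - 2) / (4 * (real l)\<^sup>2))"
proof -
  note hull = convex_hull_parabola_base [OF xy]
  consider "3/4 \<le> x" | "x = 0" | "0 < x" "x < 3/4"
    using hull by linarith
  then show thesis
  proof cases
    case 1
    then show thesis
      \<comment> \<open>The point lies in the triangle on \<open>(3/4, 1/4)\<close>,
        \<open>(1, 0)\<close> and the origin; the origin takes the missing weight.\<close>
      using hull rat by (intro that [of 1 1 "4 * y" 0 "x - 3 * y"]) auto
  next
    case 2
    then show thesis
      using hull by (intro that [of 1 1 0 0 0]) auto
  next
    case 3
    define v where "v = (\<lambda>i::nat. 3 / (4 * real i))"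
    \<comment> \<open>The floor picks the consecutive parameters with
      \<open>v (Suc k) \<le> x \<le> v k\<close>.\<close>
    define k where "k = nat \<lfloor>3 / (4 * x)\<rfloor>"
    have "1 \<le> 3 / (4 * x)"
      using 3 by simp
    then have k: "1 \<le> k" "real k \<le> 3 / (4 * x)" "3 / (4 * x) < real k + 1"
      unfolding k_def by linarith+
    define s t where "s = v k" and "t = v (Suc k)"
    have st: "t \<le> x" "x \<le> s" "t < s" "0 < t" "s \<le> 3/4"
      using k 3 by (auto simp: s_def t_def v_def field_simps)
    have rat_st: "s \<in> \<rat>" "t \<in> \<rat>"
      by (simp_all add: s_def t_def v_def)
    define h where "h = (1 - 8/9 * (s + t)) * x + 8/9 * s * t"
    have yh: "y \<le> h"
      unfolding h_def s_def t_def v_def using hull(4) [OF k(1)] .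
    have "t \<le> 3/8"
      using k(1) by (simp add: t_def v_def field_simps)
    then have h: "0 < h"
      using st 3 unfolding h_def by (intro add_nonneg_pos mult_nonneg_nonneg mult_pos_pos) auto
    \<comment> \<open>\<open>w\<close> is the height of the point relative to the chord, and
      \<open>r\<close> locates \<open>x\<close> between the ends of the chord.\<close>
    define w r where "w = y / h" and "r = (x - t) / (s - t)"
    have range: "0 \<le> w" "w \<le> 1" "0 \<le> r" "r \<le> 1"
      using h yh hull(1) st by (auto simp: w_def r_def)
    have rat': "w \<in> \<rat>" "r \<in> \<rat>"
      using rat rat_st by (auto simp: w_def r_def h_def)
    have x: "x = r * s + (1 - r) * t"
    proof -
      have "r * (s - t) = x - t"
        using st by (simp add: r_def)
      then show ?thesis
        by (simp add: algebra_simps)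
    qed
    have par: "(3 * real i - 2) / (4 * (real i)\<^sup>2) = v i - 8/9 * (v i)\<^sup>2" if "1 \<le> i" for i
      using that by (simp add: v_def field_simps power2_eq_square)
    show thesis
    \<comment> \<open>The base point \<open>(x, 0)\<close> has weight \<open>1 - w\<close> and is
      itself split as \<open>x\<close> times \<open>(1, 0)\<close> plus a multiple of the
      origin.\<close>
    proof (rule that [of k "Suc k" "w * r" "w * (1 - r)" "(1 - w) * x"])
      have "w * r + w * (1 - r) + (1 - w) * x \<le> w + (1 - w) * 1"
        using range 3 mult_left_mono [of x 1 "1 - w"] by (simp add: algebra_simps)
      then show "w * r + w * (1 - r) + (1 - w) * x \<le> 1"
        by simp
      have "w * x = w * (r * s + (1 - r) * t)"
        using x by simp
      then show "x = w * r * (3 / (4 * real k)) + w * (1 - r) * (3 / (4 * real (Suc k))) + (1 - w) * x"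
        unfolding s_def t_def v_def by (simp add: algebra_simps)
      have "h = r * (s - 8/9 * s\<^sup>2) + (1 - r) * (t - 8/9 * t\<^sup>2)"
        unfolding h_def x by (simp add: field_simps power2_eq_square)
      moreover have "y = w * h"
        using h by (simp add: w_def)
      ultimately have "y = w * r * (s - 8/9 * s\<^sup>2) + w * (1 - r) * (t - 8/9 * t\<^sup>2)"
        by (simp add: distrib_left mult.assoc)
      then show "y = w * r * ((3 * real k - 2) / (4 * (real k)\<^sup>2))
          + w * (1 - r) * ((3 * real (Suc k) - 2) / (4 * (real (Suc k))\<^sup>2))"
        using par [OF k(1)] par [of "Suc k"] by (simp add: s_def t_def)
    qed (use k rat rat' range 3 in auto)
  qed
qed

theorem theorem1p3:
  fixes x y :: real
  assumes "x \<in> \<rat>" and "y \<in> \<rat>"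
    and "(x, y) \<in> convex hull (parabola_points \<union> base_segment)"
  shows "\<exists>n p q j :: nat. p \<ge> 1 \<and> q \<ge> 1 \<and> n \<le> p * q \<and>
           x = real n / real (p * q) \<and> y = real j / real (p * q) \<and>
           \<not> trivial_group (homology_group (int j) (square_config_space n p q))"
proof -
  have "x \<le> 1"
    using convex_hull_parabola_base(1,3) [OF assms(3)] by linarith
  obtain k l :: nat and a b c :: real where "1 \<le> k" "1 \<le> l" "a \<in> \<rat>" "b \<in> \<rat>" "c \<in> \<rat>"
      "0 \<le> a" "0 \<le> b" "0 \<le> c" "a + b + c \<le> 1"
      "x = a * (3 / (4 * real k)) + b * (3 / (4 * real l)) + c"
      "y = a * ((3 * real k - 2) / (4 * (real k)\<^sup>2)) + b * ((3 * real l - 2) / (4 * (real l)\<^sup>2))"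
    using rational_weights [OF assms] .
  then have "\<exists>n p q j :: nat. p \<ge> 1 \<and> q \<ge> 1 \<and> n \<le> p * q \<and>
      x = real n / real (p * q) \<and> y = real j / real (p * q) \<and> essential_torus n p q j"
    using \<open>x \<le> 1\<close> by (intro essential_torus_of_weights)
  then show ?thesis
    unfolding essential_torus_def using nontrivial_homology_square_config_space by blast
qed

end
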